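(* Consider a Bayesian $M$-ary hypothesis testing problem with finite $M\ge2$, models $P_i=P_{Y|X=i}$, and prior probabilities $\mathbb{P}[\mathsf{H}_i]=\mathbb{P}[X=i]$ for $i\in\{1,\ldots,M\}$. Then $$\varepsilon_{X|Y}\le\sum_{1\le i<j\le M}\ \inf_{\alpha\in(0,1)}\mathbb{P}^\alpha[\mathsf{H}_i]\,\mathbb{P}^{1-\alpha}[\mathsf{H}_j]\,\exp\bigl((\alpha-1)D_\alpha(P_i\|P_j)\bigr)\le(M-1)\exp\Bigl(-\min_{i\ne j}C(P_i\|P_j)\Bigr).$$
   Context: Logarithms have an arbitrary fixed base larger than 1 and $\exp$ is the inverse of $\log$ ($\exp(-\infty)=0$). $X$ takes values in $\{1,\ldots,M\}$, $P_i$ are probability measures on a common measurable space $\mathcal{Y}$, and $Y$ has law $P_i$ conditionally on $X=i$. The minimum error probability of guessing $X$ from $Y$ is $\varepsilon_{X|Y}=\min_{\mathcal{L}}\mathbb{P}[X\ne\mathcal{L}(Y)]=1-\mathbb{E}[\max_m\mathbb{P}[X=m|Y]]$. For probability measures $P,Q$ with densities $p,q$ with respect to a common dominating measure $R$, the R\'enyi divergence of order $\alpha\in(0,1)$ is $D_\alpha(P\|Q)=\frac{1}{\alpha-1}\log\int p^\alpha q^{1-\alpha}\,\mathrm{d}R$ (equal to $+\infty$ if the integral vanishes). The Chernoff information is $C(P\|Q)=\sup_{\alpha\in(0,1)}(1-\alpha)D_\alpha(P\|Q)$. *)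

theory Defs
  imports "HOL-Probability.Probability"
begin

(* The infimum over measurable estimators is a minimum (min_error_prob_attained), and it equals
   one minus the expected maximal posterior (min_error_prob_eq_posterior). *)
definition min_error_prob ::
    "'w measure \<Rightarrow> 'y measure \<Rightarrow> nat \<Rightarrow> ('w \<Rightarrow> nat) \<Rightarrow> ('w \<Rightarrow> 'y) \<Rightarrow> real" where
  "min_error_prob \<Omega> N m X Y =
     (INF L\<in>N \<rightarrow>\<^sub>M count_space {1..m}. \<P>(\<omega> in \<Omega>. X \<omega> \<noteq> L (Y \<omega>)))"

(* The integral of p^alpha q^(1-alpha) against a dominating measure.  We take the join of P and Q
   in the lattice of measures as the dominating measure; by hellinger_integral_density below,
   any other choice of dominating measure and densities gives the same value. *)
definition hellinger_integral :: "real \<Rightarrow> 'y measure \<Rightarrow> 'y measure \<Rightarrow> real" where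
  "hellinger_integral \<alpha> P Q =
     (\<integral>y. enn2real (RN_deriv (sup P Q) P y) powr \<alpha> *
          enn2real (RN_deriv (sup P Q) Q y) powr (1 - \<alpha>) \<partial>(sup P Q))"

definition renyi_divergence :: "real \<Rightarrow> real \<Rightarrow> 'y measure \<Rightarrow> 'y measure \<Rightarrow> ereal" where
  "renyi_divergence b \<alpha> P Q =
     (if hellinger_integral \<alpha> P Q = 0 then \<infinity>
      else ereal (1 / (\<alpha> - 1) * log b (hellinger_integral \<alpha> P Q)))"

definition chernoff_information :: "real \<Rightarrow> 'y measure \<Rightarrow> 'y measure \<Rightarrow> ereal" where
  "chernoff_information b P Q = (SUP \<alpha>\<in>{0<..<1}. ereal (1 - \<alpha>) * renyi_divergence b \<alpha> P Q)"

(* The inverse of log b, extended to the extended reals. *)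
definition exp_base :: "real \<Rightarrow> ereal \<Rightarrow> ereal" where
  "exp_base b x = (case x of ereal r \<Rightarrow> ereal (b powr r) | PInfty \<Rightarrow> \<infinity> | MInfty \<Rightarrow> 0)"

lemma
  fixes P Q :: "'y measure"
  assumes fin: "finite_measure P" "finite_measure Q" and sets: "sets P = sets Q"
  shows finite_measure_sup: "finite_measure (sup P Q)"
    and emeasure_sup_le: "A \<in> sets P \<Longrightarrow> emeasure (sup P Q) A \<le> emeasure P A + emeasure Q A"
    and absolutely_continuous_sup1: "absolutely_continuous (sup P Q) P"
    and absolutely_continuous_sup2: "absolutely_continuous (sup P Q) Q"
proof -
  interpret P: finite_measure P by fact
  interpret Q: finite_measure Q by fact
  have sp: "space P = space Q" using sets by (rule sets_eq_imp_space_eq)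
  have eq: "sup P Q = sup_measure' P Q"
    using sets sp by (simp add: sup_measure_def sup_lexord_def)
  have le: "emeasure (sup P Q) A \<le> emeasure P A + emeasure Q A" if "A \<in> sets P" for A
  proof -
    have "emeasure (sup P Q) A = (SUP Y\<in>sets P. emeasure P (A \<inter> Y) + emeasure Q (A \<inter> - Y))"
      unfolding eq by (rule emeasure_sup_measure'[OF sets[symmetric] that])
    also have "\<dots> \<le> emeasure P A + emeasure Q A"
      using that sets by (intro SUP_least add_mono emeasure_mono) auto
    finally show ?thesis .
  qed
  then show "A \<in> sets P \<Longrightarrow> emeasure (sup P Q) A \<le> emeasure P A + emeasure Q A" .
  have s: "sets (sup P Q) = sets P" "space (sup P Q) = space P"
    unfolding eq using sets by simp_all
  show "finite_measure (sup P Q)"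
  proof
    have "emeasure (sup P Q) (space P) \<le> emeasure P (space P) + emeasure Q (space P)"
      by (rule le) simp
    also have "\<dots> < \<infinity>"
      using sp by (simp add: P.emeasure_eq_measure Q.emeasure_eq_measure flip: ennreal_plus)
    finally show "emeasure (sup P Q) (space (sup P Q)) \<noteq> \<infinity>" using s by simp
  qed
  show "absolutely_continuous (sup P Q) P"
    unfolding absolutely_continuous_def null_sets_def s
    using le_emeasure_sup_measure'1[OF sets[symmetric]] unfolding eq by fastforce
  show "absolutely_continuous (sup P Q) Q"
    unfolding absolutely_continuous_def null_sets_def s
    using le_emeasure_sup_measure'2[OF sets[symmetric]] sets unfolding eq by fastforce
qed

lemma hellinger_integral_density:
  fixes R :: "'y measure" and p q :: "'y \<Rightarrow> real"
  assumes R: "sigma_finite_measure R"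
    and [measurable]: "p \<in> borel_measurable R" "q \<in> borel_measurable R"
    and nonneg: "\<And>y. 0 \<le> p y" "\<And>y. 0 \<le> q y"
    and P: "P = density R (\<lambda>y. ennreal (p y))" and Q: "Q = density R (\<lambda>y. ennreal (q y))"
    and fin: "finite_measure P" "finite_measure Q"
  shows "hellinger_integral \<alpha> P Q = (\<integral>y. p y powr \<alpha> * q y powr (1 - \<alpha>) \<partial>R)"
proof -
  interpret R: sigma_finite_measure R by fact
  define S where "S = sup P Q"
  have setsP[simp]: "sets P = sets R" and setsQ[simp]: "sets Q = sets R" by (simp_all add: P Q)
  have sets: "sets P = sets Q" by simp
  have setsS[simp]: "sets S = sets R" unfolding S_def by (rule sets_sup) simp_all
  have [measurable_cong]: "sets S = sets R" by simp
  interpret S: finite_measure S unfolding S_def by (rule finite_measure_sup[OF fin sets])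
  have acP: "absolutely_continuous S P" and acQ: "absolutely_continuous S Q"
    unfolding S_def by (rule absolutely_continuous_sup1[OF fin sets] absolutely_continuous_sup2[OF fin sets])+
  have acRP: "absolutely_continuous R P" "absolutely_continuous R Q"
    unfolding P Q by (auto intro!: absolutely_continuousI_density)
  have acRS: "absolutely_continuous R S"
    unfolding absolutely_continuous_def
  proof
    fix A assume A: "A \<in> null_sets R"
    then have "emeasure P A = 0" "emeasure Q A = 0"
      using acRP by (auto simp: absolutely_continuous_def)
    then have "emeasure S A = 0"
      using emeasure_sup_le[OF fin sets, of A] A by (simp add: S_def null_setsD2)
    then show "A \<in> null_sets S" using A by (simp add: null_sets_def)
  qed
  define s u v where "s = (\<lambda>y. enn2real (RN_deriv R S y))"
    and "u = (\<lambda>y. enn2real (RN_deriv S P y))" and "v = (\<lambda>y. enn2real (RN_deriv S Q y))"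
  have [measurable]: "s \<in> borel_measurable R" "u \<in> borel_measurable S" "v \<in> borel_measurable S"
    "u \<in> borel_measurable R" "v \<in> borel_measurable R"
    unfolding s_def u_def v_def by (simp_all add: measurable_cong_sets[OF setsS refl, symmetric])
  have nn: "0 \<le> s y" "0 \<le> u y" "0 \<le> v y" for y by (simp_all add: s_def u_def v_def)
  have S_eq: "density R (\<lambda>y. ennreal (s y)) = S"
  proof -
    have "AE y in R. RN_deriv R S y = ennreal (s y)"
      using R.RN_deriv_finite[OF S.sigma_finite_measure_axioms acRS setsS]
      by eventually_elim (auto simp: s_def top.not_eq_extremum)
    then have "density R (\<lambda>y. ennreal (s y)) = density R (RN_deriv R S)"
      by (intro density_cong) auto
    then show ?thesis using R.density_RN_deriv[OF acRS setsS] by simp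
  qed
  have dens: "AE y in R. f y = s y * enn2real (RN_deriv S T y)"
    if "T = density R (\<lambda>y. ennreal (f y))" and ac: "absolutely_continuous S T"
      and [measurable]: "f \<in> borel_measurable R" and f: "\<And>y. 0 \<le> f y" and "finite_measure T" for f T
  proof -
    have setsT: "sets T = sets S" using that by simp
    interpret T: finite_measure T by fact
    have [measurable]: "RN_deriv S T \<in> borel_measurable R"
      by (simp add: measurable_cong_sets[OF setsS refl, symmetric])
    have "AE y in S. RN_deriv S T y = ennreal (enn2real (RN_deriv S T y))"
      using S.RN_deriv_finite[OF T.sigma_finite_measure_axioms ac setsT]
      by eventually_elim (auto simp: top.not_eq_extremum)
    then have "density S (\<lambda>y. ennreal (enn2real (RN_deriv S T y))) = density S (RN_deriv S T)"
      by (intro density_cong) auto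
    then have "T = density S (\<lambda>y. ennreal (enn2real (RN_deriv S T y)))"
      using S.density_RN_deriv[OF ac setsT] by simp
    also have "\<dots> = density R (\<lambda>y. ennreal (s y * enn2real (RN_deriv S T y)))"
      by (subst (1) S_eq[symmetric], subst density_density_eq) (auto simp: ennreal_mult nn)
    finally have "density R (\<lambda>y. ennreal (f y)) = density R (\<lambda>y. ennreal (s y * enn2real (RN_deriv S T y)))"
      using that by simp
    then have "AE y in R. ennreal (f y) = ennreal (s y * enn2real (RN_deriv S T y))"
      by (subst (asm) R.density_unique_iff) auto
    then show ?thesis
      by eventually_elim (simp add: f nn)
  qed
  have dP: "AE y in R. p y = s y * u y"
    unfolding u_def by (rule dens[OF P acP _ nonneg(1) fin(1)]) measurable
  have dQ: "AE y in R. q y = s y * v y"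
    unfolding v_def by (rule dens[OF Q acQ _ nonneg(2) fin(2)]) measurable
  have "hellinger_integral \<alpha> P Q = (\<integral>y. u y powr \<alpha> * v y powr (1 - \<alpha>) \<partial>S)"
    by (simp add: hellinger_integral_def u_def v_def S_def)
  also have "\<dots> = (\<integral>y. s y * (u y powr \<alpha> * v y powr (1 - \<alpha>)) \<partial>R)"
    unfolding S_eq[symmetric] by (subst integral_real_density) (auto simp: nn)
  also have "\<dots> = (\<integral>y. p y powr \<alpha> * q y powr (1 - \<alpha>) \<partial>R)"
  proof (rule integral_cong_AE)
    show "AE y in R. s y * (u y powr \<alpha> * v y powr (1 - \<alpha>)) = p y powr \<alpha> * q y powr (1 - \<alpha>)"
      using dP dQ
    proof eventually_elim
      case (elim y)
      have "s y powr \<alpha> * s y powr (1 - \<alpha>) = s y"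
        using nn(1)[of y] by (simp flip: powr_add)
      then have "s y * (u y powr \<alpha> * v y powr (1 - \<alpha>)) =
          (s y powr \<alpha> * u y powr \<alpha>) * (s y powr (1 - \<alpha>) * v y powr (1 - \<alpha>))"
        by (metis mult.assoc mult.left_commute)
      also have "\<dots> = (s y * u y) powr \<alpha> * (s y * v y) powr (1 - \<alpha>)"
        by (simp only: powr_mult)
      finally show ?case by (simp only: elim)
    qed
  qed measurable
  finally show ?thesis .
qed

lemma
  fixes \<Omega> :: "'w measure" and N :: "'y measure"
  assumes "prob_space \<Omega>" and m: "1 \<le> m"
    and X[measurable]: "X \<in> \<Omega> \<rightarrow>\<^sub>M count_space {1..m}" and Y[measurable]: "Y \<in> \<Omega> \<rightarrow>\<^sub>M N"
  shows min_error_prob_attained: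
      "\<exists>L\<in>N \<rightarrow>\<^sub>M count_space {1..m}. min_error_prob \<Omega> N m X Y = \<P>(\<omega> in \<Omega>. X \<omega> \<noteq> L (Y \<omega>))"
    and min_error_prob_eq_posterior:
      "min_error_prob \<Omega> N m X Y = 1 - (\<integral>\<omega>. Max ((\<lambda>i. real_cond_exp \<Omega> (vimage_algebra (space \<Omega>) Y N)
         (indicator {\<omega>\<in>space \<Omega>. X \<omega> = i}) \<omega>) ` {1..m}) \<partial>\<Omega>)"
proof -
  interpret prob_space \<Omega> by fact
  define D where "D = distr \<Omega> N Y"
  have setsD[measurable_cong]: "sets D = sets N" by (simp add: D_def)
  have spD: "space D = space N" by (simp add: D_def)
  interpret D: prob_space D unfolding D_def by (rule prob_space_distr) simp
  define J where "J i = distr (density \<Omega> (indicator {\<omega>\<in>space \<Omega>. X \<omega> = i})) N Y" for i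
  have setsJ: "sets (J i) = sets D" for i by (simp add: J_def D_def)
  have ev[measurable]: "{\<omega>\<in>space \<Omega>. X \<omega> = i} \<in> events" for i
  proof (cases "i \<in> {1..m}")
    case True then show ?thesis by measurable
  next
    case False
    then have "{\<omega>\<in>space \<Omega>. X \<omega> = i} = {}" using measurable_space[OF X] by auto
    then show ?thesis by (metis sets.empty_sets)
  qed
  have J: "emeasure (J i) A = prob ({\<omega>\<in>space \<Omega>. X \<omega> = i} \<inter> (Y -` A \<inter> space \<Omega>))" if [measurable]: "A \<in> sets N" for i A
  proof -
    have "emeasure (J i) A = emeasure (density \<Omega> (indicator {\<omega>\<in>space \<Omega>. X \<omega> = i})) (Y -` A \<inter> space \<Omega>)"
      unfolding J_def by (subst emeasure_distr) auto
    also have "\<dots> = emeasure \<Omega> ({\<omega>\<in>space \<Omega>. X \<omega> = i} \<inter> (Y -` A \<inter> space \<Omega>))"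
      by (subst emeasure_density) (auto simp: nn_integral_set_ennreal simp flip: indicator_inter_arith)
    finally show ?thesis by (simp add: emeasure_eq_measure)
  qed
  have JD: "emeasure (J i) A \<le> emeasure D A" if [measurable]: "A \<in> sets N" for i A
    by (subst J) (auto simp: D_def emeasure_distr emeasure_eq_measure intro!: finite_measure_mono)
  have ac: "absolutely_continuous D (J i)" for i
    unfolding absolutely_continuous_def using JD setsD setsJ by (fastforce simp: null_sets_def)
  have finJ: "finite_measure (J i)" for i
    by standard (use JD[of "space N" i] in \<open>auto simp: J_def D_def emeasure_distr emeasure_eq_measure top_unique\<close>)
  define g where "g i y = enn2real (RN_deriv D (J i) y)" for i y
  have g_mD: "g i \<in> borel_measurable D" for i unfolding g_def[abs_def] by measurable
  have g_m[measurable]: "g i \<in> borel_measurable N" for i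
    using g_mD[of i] by (simp add: measurable_cong_sets[OF setsD refl])
  have g_nn: "0 \<le> g i y" for i y by (simp add: g_def)
  have Jg: "density D (\<lambda>y. ennreal (g i y)) = J i" for i
  proof -
    interpret Ji: finite_measure "J i" by (rule finJ)
    have "AE y in D. RN_deriv D (J i) y = ennreal (g i y)"
      using D.RN_deriv_finite[OF Ji.sigma_finite_measure_axioms ac setsJ]
      by eventually_elim (auto simp: g_def top.not_eq_extremum)
    then have "density D (\<lambda>y. ennreal (g i y)) = density D (RN_deriv D (J i))"
      by (intro density_cong) (auto simp: g_mD)
    then show ?thesis using D.density_RN_deriv[OF ac setsJ] by simp
  qed
  have g_int: "integrable D (g i)" for i
  proof (rule integrableI_nonneg)
    have "(\<integral>\<^sup>+ y. ennreal (g i y) \<partial>D) = emeasure (J i) (space D)"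
      unfolding Jg[symmetric] by (subst emeasure_density)
        (auto simp: g_mD intro!: nn_integral_cong)
    also have "\<dots> < \<infinity>" using finite_measure.emeasure_finite[OF finJ, of i]
      by (simp add: less_top)
    finally show "(\<integral>\<^sup>+ y. ennreal (g i y) \<partial>D) < \<infinity>" .
  qed (auto simp: g_nn g_mD)
  have Pg: "prob {\<omega>\<in>space \<Omega>. X \<omega> = i \<and> Y \<omega> \<in> A} = (\<integral>y. indicator A y * g i y \<partial>D)" 
    if [measurable]: "A \<in> sets N" for i A
  proof -
    have "ennreal (prob {\<omega>\<in>space \<Omega>. X \<omega> = i \<and> Y \<omega> \<in> A}) = emeasure (J i) A"
      by (subst J) (auto intro!: arg_cong[where f=prob])
    also have "\<dots> = (\<integral>\<^sup>+ y. ennreal (indicator A y * g i y) \<partial>D)"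
      unfolding Jg[symmetric] by (subst emeasure_density)
        (auto simp: setsD ac_simps indicator_def intro!: nn_integral_cong)
    also have "\<dots> = ennreal (\<integral>y. indicator A y * g i y \<partial>D)"
      by (intro nn_integral_eq_integral integrable_mult_indicator[where 'b=real, simplified] g_int)
         (auto simp: g_nn setsD)
    finally show ?thesis 
      by (subst (asm) ennreal_inj) (auto intro!: integral_nonneg_AE simp: g_nn)
  qed
  define G where "G y = Max ((\<lambda>i. g i y) ` {1..m})" for y
  have ne: "{1..m} \<noteq> {}" using m by simp
  have G_m[measurable]: "G \<in> borel_measurable N"
    unfolding G_def[abs_def] using ne by (intro borel_measurable_Max) auto
  have G_ge: "g i y \<le> G y" if "i \<in> {1..m}" for i y using that by (auto simp: G_def)
  have err: "\<P>(\<omega> in \<Omega>. X \<omega> \<noteq> L (Y \<omega>)) = 1 - (\<integral>y. g (L y) y \<partial>D) \<and> integrable D (\<lambda>y. g (L y) y)" 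
    if L[measurable]: "L \<in> N \<rightarrow>\<^sub>M count_space {1..m}" for L
  proof -
    have A[measurable]: "{y\<in>space N. L y = i} \<in> sets N" if "i \<in> {1..m}" for i
      using that by measurable
    have sum_eq: "g (L y) y = (\<Sum>i\<in>{1..m}. indicator {y\<in>space N. L y = i} y * g i y)" 
      if "y \<in> space D" for y
    proof -
      have y: "y \<in> space N" using that spD by simp
      then have "L y \<in> {1..m}" using measurable_space[OF L] by simp
      moreover have "(\<Sum>i\<in>{1..m}. indicator {y\<in>space N. L y = i} y * g i y) 
          = (\<Sum>i\<in>{1..m}. if L y = i then g i y else 0)"
        using y by (intro sum.cong) (auto simp: indicator_def)
      ultimately show ?thesis by simp
    qed
    have int: "integrable D (\<lambda>y. indicator {y\<in>space N. L y = i} y * g i y)" if "i \<in> {1..m}" for i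
      using integrable_mult_indicator[of "{y\<in>space N. L y = i}" D "g i"] A[OF that] g_int
      by (simp add: setsD)
    have E: "{\<omega>\<in>space \<Omega>. X \<omega> = i \<and> Y \<omega> \<in> {y\<in>space N. L y = i}} \<in> events" if "i \<in> {1..m}" for i
    proof -
      have "{\<omega>\<in>space \<Omega>. X \<omega> = i \<and> Y \<omega> \<in> {y\<in>space N. L y = i}} = 
         {\<omega>\<in>space \<Omega>. X \<omega> = i} \<inter> (Y -` {y\<in>space N. L y = i} \<inter> space \<Omega>)" by auto
      then show ?thesis by (simp only: sets.Int[OF ev measurable_sets[OF Y A[OF that]]])
    qed
    let ?C = "{\<omega>\<in>space \<Omega>. X \<omega> = L (Y \<omega>)}"
    have un: "?C = (\<Union>i\<in>{1..m}. {\<omega>\<in>space \<Omega>. X \<omega> = i \<and> Y \<omega> \<in> {y\<in>space N. L y = i}})"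
      using measurable_space[OF L] measurable_space[OF Y] by auto
    have "prob ?C = (\<Sum>i\<in>{1..m}. prob {\<omega>\<in>space \<Omega>. X \<omega> = i \<and> Y \<omega> \<in> {y\<in>space N. L y = i}})"
      unfolding un using E by (intro finite_measure_finite_Union) (auto simp: disjoint_family_on_def)
    also have "\<dots> = (\<Sum>i\<in>{1..m}. \<integral>y. indicator {y\<in>space N. L y = i} y * g i y \<partial>D)"
      using A by (intro sum.cong refl Pg) auto
    also have "\<dots> = (\<integral>y. (\<Sum>i\<in>{1..m}. indicator {y\<in>space N. L y = i} y * g i y) \<partial>D)"
      using int by (subst Bochner_Integration.integral_sum) auto
    also have "\<dots> = (\<integral>y. g (L y) y \<partial>D)"
      using sum_eq by (intro Bochner_Integration.integral_cong) auto
    finally have C: "prob ?C = (\<integral>y. g (L y) y \<partial>D)" .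
    have "?C \<in> events" unfolding un using E by (intro sets.finite_UN) auto
    then have "prob (space \<Omega> - ?C) = 1 - prob ?C" by (rule prob_compl)
    also have "space \<Omega> - ?C = {\<omega>\<in>space \<Omega>. X \<omega> \<noteq> L (Y \<omega>)}" by auto
    finally have "\<P>(\<omega> in \<Omega>. X \<omega> \<noteq> L (Y \<omega>)) = 1 - (\<integral>y. g (L y) y \<partial>D)" using C by simp
    moreover have "integrable D (\<lambda>y. \<Sum>i\<in>{1..m}. indicator {y\<in>space N. L y = i} y * g i y)"
      using int by (intro Bochner_Integration.integrable_sum) auto
    then have "integrable D (\<lambda>y. g (L y) y)"
      by (subst Bochner_Integration.integrable_cong[OF refl sum_eq]) 
    ultimately show ?thesis by blast
  qed
  define L0 where "L0 y = (LEAST i. i \<in> {1..m} \<and> g i y = G y)" for y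
  have ex: "\<exists>i. i \<in> {1..m} \<and> g i y = G y" for y
  proof -
    have "G y \<in> (\<lambda>i. g i y) ` {1..m}"
      unfolding G_def using ne by (intro Max_in) auto
    then obtain i where "i \<in> {1..m}" "G y = g i y" by (rule imageE)
    then show ?thesis by (intro exI[of _ i] conjI) simp_all
  qed
  have L0: "L0 y \<in> {1..m} \<and> g (L0 y) y = G y" for y
    unfolding L0_def by (rule LeastI_ex[OF ex[of y]])
  have L0_m: "L0 \<in> N \<rightarrow>\<^sub>M count_space {1..m}"
  proof -
    have "(\<lambda>y. i \<in> {1..m} \<and> g i y = G y) \<in> N \<rightarrow>\<^sub>M count_space UNIV" for i by measurable
    then have "L0 \<in> N \<rightarrow>\<^sub>M count_space UNIV"
      unfolding L0_def[abs_def] by (intro measurable_Least)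
    then have "L0 -` {i} \<inter> space N \<in> sets N" for i by (rule measurable_sets) simp
    with L0 show ?thesis by (subst measurable_count_space_eq2) auto
  qed
  have gL0: "(\<lambda>y. g (L0 y) y) = G" using L0 by auto
  have min: "\<P>(\<omega> in \<Omega>. X \<omega> \<noteq> L0 (Y \<omega>)) \<le> \<P>(\<omega> in \<Omega>. X \<omega> \<noteq> L (Y \<omega>))"
    if L: "L \<in> N \<rightarrow>\<^sub>M count_space {1..m}" for L
  proof -
    have "(\<integral>y. g (L y) y \<partial>D) \<le> (\<integral>y. g (L0 y) y \<partial>D)"
    proof (rule integral_mono)
      show "integrable D (\<lambda>y. g (L y) y)" "integrable D (\<lambda>y. g (L0 y) y)"
        using err[OF L] err[OF L0_m] by blast+
      fix y assume "y \<in> space D"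
      then have "L y \<in> {1..m}" using measurable_space[OF L, of y] spD by simp
      then show "g (L y) y \<le> g (L0 y) y" using G_ge L0 by metis
    qed
    then show ?thesis using err[OF L] err[OF L0_m] by simp
  qed
  have eq: "min_error_prob \<Omega> N m X Y = \<P>(\<omega> in \<Omega>. X \<omega> \<noteq> L0 (Y \<omega>))"
    unfolding min_error_prob_def using L0_m min
    by (intro cInf_eq_minimum) auto
  then show "\<exists>L\<in>N \<rightarrow>\<^sub>M count_space {1..m}. min_error_prob \<Omega> N m X Y = \<P>(\<omega> in \<Omega>. X \<omega> \<noteq> L (Y \<omega>))"
    using L0_m by blast
  let ?F = "vimage_algebra (space \<Omega>) Y N"
  have sub: "subalgebra \<Omega> ?F"
    unfolding subalgebra_def
  proof (intro conjI subsetI)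
    have f: "Y \<in> space \<Omega> \<rightarrow> space N" using measurable_space[OF Y] by auto
    fix B assume "B \<in> sets ?F"
    then obtain A where "A \<in> sets N" "B = Y -` A \<inter> space \<Omega>"
      unfolding sets_vimage_algebra2[OF f] by blast
    then show "B \<in> events" using measurable_sets[OF Y] by simp
  qed simp
  interpret F: finite_measure_subalgebra \<Omega> ?F by (standard, rule sub)
  have YF[measurable]: "Y \<in> ?F \<rightarrow>\<^sub>M N" using measurable_space[OF Y] by (intro measurable_vimage_algebra1) auto
  have ce: "AE \<omega> in \<Omega>. real_cond_exp \<Omega> ?F (indicator {\<omega>\<in>space \<Omega>. X \<omega> = i}) \<omega> = g i (Y \<omega>)" for i
  proof (rule F.real_cond_exp_charact)
    show "integrable \<Omega> (indicator {\<omega>\<in>space \<Omega>. X \<omega> = i} :: _ \<Rightarrow> real)"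
      using ev[of i] by (simp add: integrable_indicator_iff emeasure_eq_measure)
    show "integrable \<Omega> (\<lambda>\<omega>. g i (Y \<omega>))"
      using g_int[of i] unfolding D_def by (rule integrable_distr[rotated]) simp
    show "(\<lambda>\<omega>. g i (Y \<omega>)) \<in> borel_measurable ?F" by measurable
    fix B assume "B \<in> sets ?F"
    then obtain A where A: "A \<in> sets N" and B: "B = Y -` A \<inter> space \<Omega>"
      using measurable_space[OF Y] by (auto simp: sets_vimage_algebra2)
    note A[measurable]
    have "(\<integral>\<omega>\<in>B. indicator {\<omega>\<in>space \<Omega>. X \<omega> = i} \<omega> \<partial>\<Omega>) = (\<integral>\<omega>. indicator {\<omega>\<in>space \<Omega>. X \<omega> = i \<and> Y \<omega> \<in> A} \<omega> \<partial>\<Omega>)"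
      unfolding set_lebesgue_integral_def
      by (intro Bochner_Integration.integral_cong) (auto simp: B indicator_def)
    also have "\<dots> = prob {\<omega>\<in>space \<Omega>. X \<omega> = i \<and> Y \<omega> \<in> A}"
      by (simp add: Int_absorb2 Collect_mono_iff subset_eq Int_def conj_ac cong: conj_cong)
    also have "\<dots> = (\<integral>y. indicator A y * g i y \<partial>D)" by (rule Pg[OF A])
    also have "\<dots> = (\<integral>\<omega>. indicator A (Y \<omega>) * g i (Y \<omega>) \<partial>\<Omega>)"
      unfolding D_def by (rule integral_distr) measurable
    also have "\<dots> = (\<integral>\<omega>\<in>B. g i (Y \<omega>) \<partial>\<Omega>)"
      unfolding set_lebesgue_integral_def
      by (intro Bochner_Integration.integral_cong) (auto simp: B indicator_def)
    finally show "(\<integral>\<omega>\<in>B. indicator {\<omega>\<in>space \<Omega>. X \<omega> = i} \<omega> \<partial>\<Omega>) = (\<integral>\<omega>\<in>B. g i (Y \<omega>) \<partial>\<Omega>)" .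
  qed
  have "min_error_prob \<Omega> N m X Y = 1 - (\<integral>y. G y \<partial>D)"
    using eq err[OF L0_m] unfolding gL0 by simp
  also have "(\<integral>y. G y \<partial>D) = (\<integral>\<omega>. G (Y \<omega>) \<partial>\<Omega>)"
    unfolding D_def by (rule integral_distr) measurable
  also have "\<dots> = (\<integral>\<omega>. Max ((\<lambda>i. real_cond_exp \<Omega> ?F (indicator {\<omega>\<in>space \<Omega>. X \<omega> = i}) \<omega>) ` {1..m}) \<partial>\<Omega>)"
  proof (rule integral_cong_AE)
    have "AE \<omega> in \<Omega>. \<forall>i\<in>{1..m}. real_cond_exp \<Omega> ?F (indicator {\<omega>\<in>space \<Omega>. X \<omega> = i}) \<omega> = g i (Y \<omega>)"
      using ce by (intro AE_finite_allI) auto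
    then show "AE \<omega> in \<Omega>. G (Y \<omega>) = Max ((\<lambda>i. real_cond_exp \<Omega> ?F (indicator {\<omega>\<in>space \<Omega>. X \<omega> = i}) \<omega>) ` {1..m})"
      by eventually_elim (auto simp: G_def intro!: arg_cong[where f=Max] image_cong)
    show "(\<lambda>\<omega>. Max ((\<lambda>i. real_cond_exp \<Omega> ?F (indicator {\<omega>\<in>space \<Omega>. X \<omega> = i}) \<omega>) ` {1..m})) \<in> borel_measurable \<Omega>"
      using ne by (intro borel_measurable_Max) auto
  qed measurable
  finally show "min_error_prob \<Omega> N m X Y = 1 - (\<integral>\<omega>. Max ((\<lambda>i. real_cond_exp \<Omega> ?F
         (indicator {\<omega>\<in>space \<Omega>. X \<omega> = i}) \<omega>) ` {1..m}) \<partial>\<Omega>)" .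
qed

end

theory Submission
  imports Defs
begin

text \<open>
  Write \<open>a i\<close> for the prior of \<open>i\<close> times a density of \<open>P i\<close>. The maximum a posteriori
  rule errs with probability \<open>\<integral> (\<Sum>i. a i) - max a\<close>. Pairing every non-maximal index with the
  maximal one bounds the integrand by \<open>\<Sum>i<j. min (a i) (a j)\<close>, and the minimum of two numbers
  is at most any weighted geometric mean of them. For the second inequality the prior factor of
  the pair \<open>(i, j)\<close> is at most the sum of both priors, uniformly in the order, and these sums
  add up to \<open>m - 1\<close> over all pairs.
\<close>

section \<open>Hellinger integrals and the extended exponential\<close>

lemma hellinger_integral_nonneg: "0 \<le> hellinger_integral \<alpha> P Q"
  unfolding hellinger_integral_def by (intro Bochner_Integration.integral_nonneg) simp

lemma exp_base_nonneg: "0 \<le> exp_base b x"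
  by (cases x) (auto simp: exp_base_def)

lemma exp_base_mono:
  assumes "1 < b" "x \<le> y"
  shows "exp_base b x \<le> exp_base b y"
  using assms by (cases x; cases y) (auto simp: exp_base_def powr_mono)

text \<open>The factor \<open>\<alpha> - 1\<close> cancels the normalisation of the divergence, so
  exponential and logarithm undo each other. If the integral vanishes, the divergence is
  \<infinity>, its negative multiple is \<open>-\<infinity>\<close>, and \<open>exp_base\<close>
  returns 0, again the integral.\<close>

lemma exp_base_renyi_divergence:
  assumes "1 < b" "\<alpha> < 1"
  shows "exp_base b (ereal (\<alpha> - 1) * renyi_divergence b \<alpha> P Q) = ereal (hellinger_integral \<alpha> P Q)"
proof (cases "hellinger_integral \<alpha> P Q = 0")
  case True
  then show ?thesis using assms by (simp add: renyi_divergence_def exp_base_def)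
next
  case False
  then have "0 < hellinger_integral \<alpha> P Q" using hellinger_integral_nonneg[of \<alpha> P Q] by simp
  with False assms show ?thesis by (simp add: renyi_divergence_def exp_base_def)
qed

text \<open>For positive \<open>r\<close>, taking logarithms turns a lower bound on all Hellinger
  integrals into an upper bound on \<open>(1 - \<alpha>)\<close> times the divergence that is
  uniform in the order and hence passes to the supremum. For other \<open>r\<close> the left side is
  at most 0.\<close>

lemma le_exp_base_chernoff_information:
  assumes b: "1 < b" and r: "\<And>\<alpha>. \<alpha> \<in> {0<..<1} \<Longrightarrow> r \<le> hellinger_integral \<alpha> P Q"
  shows "ereal r \<le> exp_base b (- chernoff_information b P Q)"
proof (cases "0 < r")
  case True
  have "chernoff_information b P Q \<le> ereal (- log b r)"
    unfolding chernoff_information_def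
  proof (rule SUP_least)
    fix \<alpha> :: real assume \<alpha>: "\<alpha> \<in> {0<..<1}"
    \<comment> \<open>Positivity of \<open>r\<close> forces a nonzero integral, which excludes the
      infinite branch of \<open>renyi_divergence\<close>.\<close>
    have "log b r \<le> log b (hellinger_integral \<alpha> P Q)" "hellinger_integral \<alpha> P Q \<noteq> 0"
      using r[OF \<alpha>] True b by auto
    moreover have "(1 - \<alpha>) * (1 / (\<alpha> - 1) * t) = - t" for t
      using \<alpha> by (simp add: field_simps)
    ultimately show "ereal (1 - \<alpha>) * renyi_divergence b \<alpha> P Q \<le> ereal (- log b r)"
      by (simp only: renyi_divergence_def if_False times_ereal.simps) simp
  qed
  then have "ereal (log b r) \<le> - chernoff_information b P Q"
    using ereal_minus_le_minus by (metis ereal_uminus_uminus uminus_ereal.simps(1))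
  from exp_base_mono[OF b this] show ?thesis
    using True b by (simp add: exp_base_def)
next
  case False
  then show ?thesis by (intro order_trans[OF _ exp_base_nonneg]) simp
qed

section \<open>Weighted geometric means\<close>

lemma min_le_weighted_geometric_mean:
  fixes x y :: real
  assumes "0 \<le> x" "0 \<le> y" "0 \<le> \<alpha>" "\<alpha> \<le> 1"
  shows "min x y \<le> x powr \<alpha> * y powr (1 - \<alpha>)"
proof -
  let ?z = "min x y"
  \<comment> \<open>The exponents add up to 1, so the minimum is its own weighted mean; enlarging
    the two bases to \<open>x\<close> and \<open>y\<close> can only increase it.\<close>
  have "?z = ?z powr \<alpha> * ?z powr (1 - \<alpha>)"
    using assms by (simp flip: powr_add)
  also have "\<dots> \<le> x powr \<alpha> * y powr (1 - \<alpha>)"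
    using assms by (intro mult_mono powr_mono2) auto
  finally show ?thesis .
qed

text \<open>Both bases may be enlarged to \<open>x + y\<close>, and the exponents add up to 1. The
  bound does not depend on the order, as the second inequality of the theorem requires; it also
  dominates the Hellinger integrand.\<close>

lemma weighted_geometric_mean_le_add:
  fixes x y :: real
  assumes "0 \<le> x" "0 \<le> y" "0 \<le> \<alpha>" "\<alpha> \<le> 1"
  shows "x powr \<alpha> * y powr (1 - \<alpha>) \<le> x + y"
proof -
  have "x powr \<alpha> * y powr (1 - \<alpha>) \<le> (x + y) powr \<alpha> * (x + y) powr (1 - \<alpha>)"
    using assms by (intro mult_mono powr_mono2) auto
  also have "\<dots> = x + y"
    using assms by (simp flip: powr_add)
  finally show ?thesis .
qed

text \<open>The weighted mean of \<open>c * p y\<close> and \<open>d * q y\<close> splits into a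
  constant and the Hellinger integrand. By \<open>hellinger_integral_density\<close> the integral
  may be taken against \<open>R\<close> instead of \<open>sup P Q\<close>.\<close>

lemma integral_min_le_hellinger_integral:
  fixes p q :: "'y \<Rightarrow> real"
  assumes R: "sigma_finite_measure R"
    and int: "integrable R p" "integrable R q"
    and nonneg: "\<And>y. 0 \<le> p y" "\<And>y. 0 \<le> q y"
    and P: "P = density R (\<lambda>y. ennreal (p y))" and Q: "Q = density R (\<lambda>y. ennreal (q y))"
    and fin: "finite_measure P" "finite_measure Q"
    and c: "0 \<le> c" "0 \<le> d" and \<alpha>: "0 \<le> \<alpha>" "\<alpha> \<le> 1"
  shows "(\<integral>y. min (c * p y) (d * q y) \<partial>R) \<le> c powr \<alpha> * d powr (1 - \<alpha>) * hellinger_integral \<alpha> P Q"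
proof -
  have [measurable]: "p \<in> borel_measurable R" "q \<in> borel_measurable R" using int by auto
  have H: "hellinger_integral \<alpha> P Q = (\<integral>y. p y powr \<alpha> * q y powr (1 - \<alpha>) \<partial>R)"
    by (rule hellinger_integral_density[OF R _ _ nonneg P Q fin]) measurable
  \<comment> \<open>Needed for monotonicity: the Bochner integral of a non-integrable function is 0
    by convention.\<close>
  have i: "integrable R (\<lambda>y. p y powr \<alpha> * q y powr (1 - \<alpha>))"
  proof (rule Bochner_Integration.integrable_bound[OF Bochner_Integration.integrable_add[OF int]])
    show "AE y in R. norm (p y powr \<alpha> * q y powr (1 - \<alpha>)) \<le> norm (p y + q y)"
      using nonneg \<alpha> by (intro AE_I2) (simp add: weighted_geometric_mean_le_add)
  qed measurable
  have "(\<integral>y. min (c * p y) (d * q y) \<partial>R)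
      \<le> (\<integral>y. c powr \<alpha> * d powr (1 - \<alpha>) * (p y powr \<alpha> * q y powr (1 - \<alpha>)) \<partial>R)"
  proof (rule integral_mono)
    show "integrable R (\<lambda>y. min (c * p y) (d * q y))" using int by auto
    show "integrable R (\<lambda>y. c powr \<alpha> * d powr (1 - \<alpha>) * (p y powr \<alpha> * q y powr (1 - \<alpha>)))"
      using i by simp
    fix y
    have "min (c * p y) (d * q y) \<le> (c * p y) powr \<alpha> * (d * q y) powr (1 - \<alpha>)"
      using nonneg c \<alpha> by (intro min_le_weighted_geometric_mean) auto
    then show "min (c * p y) (d * q y) \<le> c powr \<alpha> * d powr (1 - \<alpha>) * (p y powr \<alpha> * q y powr (1 - \<alpha>))"
      by (simp add: powr_mult mult_ac)
  qed
  then show ?thesis by (simp add: H)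
qed

section \<open>Sums over ordered pairs of indices\<close>

lemma finite_ordered_pairs: "finite {(i, j). 1 \<le> i \<and> i < j \<and> j \<le> (m :: nat)}"
  by (rule finite_subset[of _ "{1..m} \<times> {1..m}"]) auto

text \<open>Since \<open>k\<close> is a maximiser, \<open>a i\<close> is the minimum over the pair
  of \<open>i\<close> and \<open>k\<close>. Different \<open>i\<close> give different pairs, so the
  left side is a partial sum of the nonnegative right side.\<close>

lemma sum_le_sum_pairs_min:
  fixes a :: "nat \<Rightarrow> real"
  assumes k: "k \<in> {1..m}" and nonneg: "\<And>i. i \<in> {1..m} \<Longrightarrow> 0 \<le> a i"
    and max: "\<And>i. i \<in> {1..m} \<Longrightarrow> a i \<le> a k"
  shows "(\<Sum>i\<in>{1..m} - {k}. a i) \<le> (\<Sum>(i, j)\<in>{(i, j). 1 \<le> i \<and> i < j \<and> j \<le> m}. min (a i) (a j))"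
proof -
  \<comment> \<open>The pair is sorted so that it lies in the index set of the right side.\<close>
  define h where "h i = (min i k, max i k)" for i
  have inj: "inj_on h ({1..m} - {k})"
    by (auto simp: inj_on_def h_def min_def max_def split: if_splits)
  have "(\<Sum>i\<in>{1..m} - {k}. a i) = (\<Sum>i\<in>{1..m} - {k}. case h i of (i, j) \<Rightarrow> min (a i) (a j))"
  proof (intro sum.cong refl)
    fix i assume "i \<in> {1..m} - {k}"
    then have "a i \<le> a k" using max by simp
    then show "a i = (case h i of (i, j) \<Rightarrow> min (a i) (a j))"
      by (cases "i \<le> k") (simp_all add: h_def min.absorb1 min.absorb2)
  qed
  also have "\<dots> = (\<Sum>(i, j)\<in>h ` ({1..m} - {k}). min (a i) (a j))"
    by (subst sum.reindex[OF inj]) (simp add: o_def)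
  also have "\<dots> \<le> (\<Sum>(i, j)\<in>{(i, j). 1 \<le> i \<and> i < j \<and> j \<le> m}. min (a i) (a j))"
    using k nonneg by (intro sum_mono2 finite_ordered_pairs) (auto simp: h_def)
  finally show ?thesis .
qed

text \<open>Index \<open>i\<close> is the first component of \<open>m - i\<close> pairs and the
  second component of \<open>i - 1\<close> pairs, hence occurs \<open>m - 1\<close> times in
  all.\<close>

lemma sum_ordered_pairs_add:
  fixes f :: "nat \<Rightarrow> real"
  assumes "1 \<le> m"
  shows "(\<Sum>(i, j)\<in>{(i, j). 1 \<le> i \<and> i < j \<and> j \<le> m}. f i + f j) = (real m - 1) * (\<Sum>i\<in>{1..m}. f i)"
proof -
  have A: "{(i, j). 1 \<le> i \<and> i < j \<and> j \<le> m} = (SIGMA i:{1..m}. {i<..m})"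
    by auto
  have B: "(\<Sum>(i, j)\<in>(SIGMA i:{1..m}. {i<..m}). f j) = (\<Sum>(j, i)\<in>(SIGMA j:{1..m}. {1..<j}). f j)"
    by (rule sum.reindex_bij_witness[of _ prod.swap prod.swap]) auto
  have "(\<Sum>(i, j)\<in>{(i, j). 1 \<le> i \<and> i < j \<and> j \<le> m}. f i + f j)
      = (\<Sum>(i, j)\<in>(SIGMA i:{1..m}. {i<..m}). f i) + (\<Sum>(i, j)\<in>(SIGMA i:{1..m}. {i<..m}). f j)"
    unfolding A by (simp add: sum.distrib split_def)
  also have "\<dots> = (\<Sum>i\<in>{1..m}. real (m - i) * f i) + (\<Sum>i\<in>{1..m}. real (i - 1) * f i)"
    unfolding B by (subst (1 2) sum.Sigma[symmetric]) auto
  also have "\<dots> = (\<Sum>i\<in>{1..m}. (real m - 1) * f i)"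
    unfolding sum.distrib[symmetric]
    by (intro sum.cong refl) (auto simp: of_nat_diff algebra_simps)
  finally show ?thesis by (simp add: sum_distrib_left)
qed

section \<open>Real densities and the maximum a posteriori rule\<close>

lemma (in sigma_finite_measure) finite_measure_real_density:
  assumes "finite_measure P" "absolutely_continuous M P" "sets P = sets M"
  obtains g :: "'a \<Rightarrow> real" where "integrable M g" "\<And>y. 0 \<le> g y" "P = density M (\<lambda>y. ennreal (g y))"
proof -
  \<comment> \<open>This representative is real and nonnegative everywhere, as the pointwise
    estimates demand, but agrees with \<open>RN_deriv\<close> only almost everywhere.\<close>
  obtain g where g: "g \<in> borel_measurable M" "AE y in M. RN_deriv M P y = ennreal (g y)" "\<And>y. 0 \<le> g y"
    using real_RN_deriv[OF assms] by blast
  have "density M (\<lambda>y. ennreal (g y)) = density M (RN_deriv M P)"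
    using g by (intro density_cong) (auto elim: eventually_mono)
  then have P: "P = density M (\<lambda>y. ennreal (g y))"
    using density_RN_deriv[OF assms(2,3)] by simp
  have "integrable M g"
  proof (rule integrableI_nonneg)
    have "(\<integral>\<^sup>+ y. ennreal (g y) \<partial>M) = emeasure P (space M)"
      unfolding P using g(1) by (subst emeasure_density) (auto intro!: nn_integral_cong)
    also have "\<dots> < \<infinity>"
      using finite_measure.emeasure_finite[OF assms(1)] by (simp add: less_top)
    finally show "(\<integral>\<^sup>+ y. ennreal (g y) \<partial>M) < \<infinity>" .
  qed (use g in auto)
  with P g(3) show ?thesis using that by blast
qed

text \<open>Breaking ties by the least index keeps the choice measurable, because for each
  \<open>i\<close> the predicate that \<open>i\<close> is a maximiser is measurable.\<close>

lemma measurable_argmax_exists: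
  fixes a :: "nat \<Rightarrow> 'y \<Rightarrow> real"
  assumes m: "1 \<le> m" and [measurable]: "\<And>i. i \<in> {1..m} \<Longrightarrow> a i \<in> borel_measurable N"
  obtains L where "L \<in> N \<rightarrow>\<^sub>M count_space {1..m}"
    "\<And>y. L y \<in> {1..m}" "\<And>y i. i \<in> {1..m} \<Longrightarrow> a i y \<le> a (L y) y"
proof -
  define L where "L y = (LEAST i. i \<in> {1..m} \<and> (\<forall>j\<in>{1..m}. a j y \<le> a i y))" for y
  have "\<exists>i. i \<in> {1..m} \<and> (\<forall>j\<in>{1..m}. a j y \<le> a i y)" for y
  proof -
    have "Max ((\<lambda>i. a i y) ` {1..m}) \<in> (\<lambda>i. a i y) ` {1..m}"
      using m by (intro Max_in) auto
    then obtain i where i: "i \<in> {1..m}" "Max ((\<lambda>i. a i y) ` {1..m}) = a i y"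
      by (rule imageE)
    have "a j y \<le> a i y" if "j \<in> {1..m}" for j
      unfolding i(2)[symmetric] using that by (intro Max_ge) auto
    with i(1) show ?thesis by blast
  qed
  then have L: "L y \<in> {1..m} \<and> (\<forall>j\<in>{1..m}. a j y \<le> a (L y) y)" for y
    unfolding L_def by (rule LeastI_ex)
  have "(\<lambda>y. i \<in> {1..m} \<and> (\<forall>j\<in>{1..m}. a j y \<le> a i y)) \<in> N \<rightarrow>\<^sub>M count_space UNIV" for i
  proof (cases "i \<in> {1..m}")
    case True
    then have "(\<lambda>y. \<forall>j\<in>{1..m}. a j y \<le> a i y) \<in> N \<rightarrow>\<^sub>M count_space UNIV" by measurable
    with True show ?thesis by simp
  next
    case False
    then show ?thesis by (subst measurable_cong[where g="\<lambda>_. False"]) auto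
  qed
  then have "L \<in> N \<rightarrow>\<^sub>M count_space UNIV"
    unfolding L_def[abs_def] by (intro measurable_Least)
  then have "L -` {i} \<inter> space N \<in> sets N" for i by (rule measurable_sets) simp
  with L have "L \<in> N \<rightarrow>\<^sub>M count_space {1..m}"
    by (subst measurable_count_space_eq2) auto
  with L show ?thesis using that by blast
qed

text \<open>The infimum over estimators is bounded by the error of one of them, the pointwise
  maximiser of \<open>a\<close>. Its error is the integral of all \<open>a i y\<close> except the
  maximal one, to which \<open>sum_le_sum_pairs_min\<close> applies.\<close>

lemma min_error_prob_le_sum_integral_min:
  fixes \<Omega> :: "'w measure" and N D :: "'y measure" and a :: "nat \<Rightarrow> 'y \<Rightarrow> real"
  assumes "prob_space \<Omega>" and m: "1 \<le> m"
    and X[measurable]: "X \<in> \<Omega> \<rightarrow>\<^sub>M count_space {1..m}" and Y[measurable]: "Y \<in> \<Omega> \<rightarrow>\<^sub>M N"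
    and setsD: "sets D = sets N"
    and int: "\<And>i. i \<in> {1..m} \<Longrightarrow> integrable D (a i)" and nonneg: "\<And>i y. 0 \<le> a i y"
    and joint: "\<And>i A. i \<in> {1..m} \<Longrightarrow> A \<in> sets N \<Longrightarrow>
       \<P>(\<omega> in \<Omega>. X \<omega> = i \<and> Y \<omega> \<in> A) = (\<integral>y. indicator A y * a i y \<partial>D)"
  shows "min_error_prob \<Omega> N m X Y
    \<le> (\<Sum>(i, j)\<in>{(i, j). 1 \<le> i \<and> i < j \<and> j \<le> m}. \<integral>y. min (a i y) (a j y) \<partial>D)"
proof -
  interpret prob_space \<Omega> by fact
  have spD: "space D = space N" using setsD by (rule sets_eq_imp_space_eq)
  have a_m: "a i \<in> borel_measurable N" if "i \<in> {1..m}" for i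
    using int[OF that] by (simp add: measurable_cong_sets[OF setsD refl, symmetric])
  obtain L where L[measurable]: "L \<in> N \<rightarrow>\<^sub>M count_space {1..m}"
    and L_in: "\<And>y. L y \<in> {1..m}" and L_max: "\<And>y i. i \<in> {1..m} \<Longrightarrow> a i y \<le> a (L y) y"
    using measurable_argmax_exists[of m a N] m a_m by blast
  \<comment> \<open>The region where the rule does not answer \<open>i\<close>: given
    \<open>X = i\<close>, an error means that \<open>Y\<close> falls into
    \<open>A i\<close>.\<close>
  define A where "A i = {y\<in>space N. L y \<noteq> i}" for i
  have A[measurable]: "A i \<in> sets N" if "i \<in> {1..m}" for i
    unfolding A_def using that by measurable
  have intA: "integrable D (\<lambda>y. indicator (A i) y * a i y)" if "i \<in> {1..m}" for i
    using integrable_mult_indicator[OF _ int[OF that], of "A i"] A[OF that] by (simp add: setsD)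
  have ev: "{\<omega>\<in>space \<Omega>. X \<omega> = i \<and> Y \<omega> \<in> A i} \<in> events" if "i \<in> {1..m}" for i
  proof -
    have "X -` {i} \<inter> space \<Omega> \<in> events" using that by (intro measurable_sets[OF X]) auto
    moreover have "Y -` A i \<inter> space \<Omega> \<in> events" by (intro measurable_sets[OF Y] A that)
    moreover have "{\<omega>\<in>space \<Omega>. X \<omega> = i \<and> Y \<omega> \<in> A i} = (X -` {i} \<inter> space \<Omega>) \<inter> (Y -` A i \<inter> space \<Omega>)"
      by auto
    ultimately show ?thesis by (simp only: sets.Int)
  qed
  have "min_error_prob \<Omega> N m X Y \<le> \<P>(\<omega> in \<Omega>. X \<omega> \<noteq> L (Y \<omega>))"
    unfolding min_error_prob_def
    by (rule cINF_lower) (use L in \<open>auto intro!: bdd_belowI[of _ 0]\<close>)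
  also have "{\<omega>\<in>space \<Omega>. X \<omega> \<noteq> L (Y \<omega>)} = (\<Union>i\<in>{1..m}. {\<omega>\<in>space \<Omega>. X \<omega> = i \<and> Y \<omega> \<in> A i})"
    using measurable_space[OF X] measurable_space[OF Y] by (auto simp: A_def)
  also have "prob \<dots> = (\<Sum>i\<in>{1..m}. \<P>(\<omega> in \<Omega>. X \<omega> = i \<and> Y \<omega> \<in> A i))"
    using ev by (intro finite_measure_finite_Union) (auto simp: disjoint_family_on_def)
  also have "\<dots> = (\<Sum>i\<in>{1..m}. \<integral>y. indicator (A i) y * a i y \<partial>D)"
    using A by (intro sum.cong joint) auto
  also have "\<dots> = (\<integral>y. (\<Sum>i\<in>{1..m}. indicator (A i) y * a i y) \<partial>D)"
    using intA by (subst Bochner_Integration.integral_sum) auto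
  also have "\<dots> \<le> (\<integral>y. (\<Sum>(i, j)\<in>{(i, j). 1 \<le> i \<and> i < j \<and> j \<le> m}. min (a i y) (a j y)) \<partial>D)"
  proof (rule integral_mono)
    show "integrable D (\<lambda>y. \<Sum>i\<in>{1..m}. indicator (A i) y * a i y)"
      using intA by (intro Bochner_Integration.integrable_sum) auto
    show "integrable D (\<lambda>y. \<Sum>(i, j)\<in>{(i, j). 1 \<le> i \<and> i < j \<and> j \<le> m}. min (a i y) (a j y))"
      using int unfolding split_def by (intro Bochner_Integration.integrable_sum integrable_min) auto
    fix y assume "y \<in> space D"
    \<comment> \<open>At \<open>y\<close> every indicator is 1 except the one of the chosen index
      \<open>L y\<close>.\<close>
    then have "(\<Sum>i\<in>{1..m}. indicator (A i) y * a i y) = (\<Sum>i\<in>{1..m} - {L y}. a i y)"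
      by (intro sum.mono_neutral_cong_right) (auto simp: A_def spD indicator_def)
    also have "\<dots> \<le> (\<Sum>(i, j)\<in>{(i, j). 1 \<le> i \<and> i < j \<and> j \<le> m}. min (a i y) (a j y))"
      using L_in L_max nonneg by (intro sum_le_sum_pairs_min) auto
    finally show "(\<Sum>i\<in>{1..m}. indicator (A i) y * a i y)
        \<le> (\<Sum>(i, j)\<in>{(i, j). 1 \<le> i \<and> i < j \<and> j \<le> m}. min (a i y) (a j y))" .
  qed
  also have "\<dots> = (\<Sum>(i, j)\<in>{(i, j). 1 \<le> i \<and> i < j \<and> j \<le> m}. \<integral>y. min (a i y) (a j y) \<partial>D)"
    unfolding split_def using int by (intro Bochner_Integration.integral_sum integrable_min) auto
  finally show ?thesis .
qed

theorem theorem15: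
  fixes \<Omega> :: "'w measure" and N :: "'y measure"
    and X :: "'w \<Rightarrow> nat" and Y :: "'w \<Rightarrow> 'y"
    and P :: "nat \<Rightarrow> 'y measure" and m :: nat and b :: real
  assumes "1 < b" and "2 \<le> m"
    and "prob_space \<Omega>"
    and "X \<in> \<Omega> \<rightarrow>\<^sub>M count_space {1..m}" and "Y \<in> \<Omega> \<rightarrow>\<^sub>M N"
    and "\<And>i. i \<in> {1..m} \<Longrightarrow> prob_space (P i)"
    and "\<And>i. i \<in> {1..m} \<Longrightarrow> sets (P i) = sets N"
    and "\<And>i A. \<lbrakk>i \<in> {1..m}; \<P>(\<omega> in \<Omega>. X \<omega> = i) > 0; A \<in> sets N\<rbrakk> \<Longrightarrow>
           \<P>(\<omega> in \<Omega>. Y \<omega> \<in> A \<bar> X \<omega> = i) = measure (P i) A"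
  shows "let prior = \<lambda>i. \<P>(\<omega> in \<Omega>. X \<omega> = i);
             S = \<Sum>(i, j)\<in>{(i, j). 1 \<le> i \<and> i < j \<and> j \<le> m}.
               INF \<alpha>\<in>{0<..<1}. ereal (prior i powr \<alpha> * prior j powr (1 - \<alpha>)) *
                 exp_base b (ereal (\<alpha> - 1) * renyi_divergence b \<alpha> (P i) (P j))
         in ereal (min_error_prob \<Omega> N m X Y) \<le> S \<and>
            S \<le> ereal (real m - 1) *
                exp_base b (- Min {chernoff_information b (P i) (P j) | i j.
                  i \<in> {1..m} \<and> j \<in> {1..m} \<and> i \<noteq> j})"
proof -
  interpret prob_space \<Omega> by fact
  note b = \<open>1 < b\<close> and m = \<open>2 \<le> m\<close>
  note X[measurable] = \<open>X \<in> \<Omega> \<rightarrow>\<^sub>M count_space {1..m}\<close>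
  note Y[measurable] = \<open>Y \<in> \<Omega> \<rightarrow>\<^sub>M N\<close>
  note Pp = assms(6) and setsP = assms(7) and cond = assms(8)
  define prior where "prior i = \<P>(\<omega> in \<Omega>. X \<omega> = i)" for i
  have prior_nn: "0 \<le> prior i" for i by (simp add: prior_def)
  let ?I = "{(i, j). 1 \<le> i \<and> i < j \<and> j \<le> m}"
  define H where "H \<alpha> i j = hellinger_integral \<alpha> (P i) (P j)" for \<alpha> i j
  define T where "T i j = (INF \<alpha>\<in>{0<..<1}. ereal (prior i powr \<alpha> * prior j powr (1 - \<alpha>)) *
      exp_base b (ereal (\<alpha> - 1) * renyi_divergence b \<alpha> (P i) (P j)))" for i j
  define E where "E = exp_base b (- Min {chernoff_information b (P i) (P j) | i j.
      i \<in> {1..m} \<and> j \<in> {1..m} \<and> i \<noteq> j})"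
  \<comment> \<open>From here on every term of the middle sum is an infimum of real multiples of
    Hellinger integrals.\<close>
  have T: "T i j = (INF \<alpha>\<in>{0<..<1}. ereal (prior i powr \<alpha> * prior j powr (1 - \<alpha>) * H \<alpha> i j))" for i j
    unfolding T_def H_def using b by (intro INF_cong refl) (simp add: exp_base_renyi_divergence)
  have H_nn: "0 \<le> H \<alpha> i j" for \<alpha> i j
    by (simp add: H_def hellinger_integral_nonneg)

  \<comment> \<open>Joint law of \<open>X\<close> and \<open>Y\<close>\<close>
  have Xi: "{\<omega>\<in>space \<Omega>. X \<omega> = i} \<in> events" if "i \<in> {1..m}" for i
    using that by measurable
  have joint_prior: "\<P>(\<omega> in \<Omega>. X \<omega> = i \<and> Y \<omega> \<in> A) = prior i * measure (P i) A"
    if i: "i \<in> {1..m}" and A: "A \<in> sets N" for i A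
  proof (cases "prior i = 0")
    \<comment> \<open>The conditional law is prescribed only for positive priors; at prior 0 both
      sides vanish.\<close>
    case True
    have "\<P>(\<omega> in \<Omega>. X \<omega> = i \<and> Y \<omega> \<in> A) \<le> prior i"
      unfolding prior_def using Xi[OF i] by (intro finite_measure_mono) auto
    with True show ?thesis by (simp add: measure_le_0_iff)
  next
    case False
    then have "0 < prior i" using prior_nn[of i] by simp
    then show ?thesis using cond[OF i _ A]
      by (simp add: cond_prob_def prior_def field_simps conj_commute)
  qed

  \<comment> \<open>Densities with respect to the law of \<open>Y\<close>\<close>
  define D where "D = distr \<Omega> N Y"
  have setsD: "sets D = sets N" by (simp add: D_def)
  interpret D: prob_space D unfolding D_def by (rule prob_space_distr) simp
  have "\<exists>g. integrable D g \<and> (\<forall>y. 0 \<le> g y) \<and> P i = density D (\<lambda>y. ennreal (g y))"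
    if i: "i \<in> {1..m}" and pos: "0 < prior i" for i
  proof -
    interpret Pi: prob_space "P i" by (rule Pp[OF i])
    have "absolutely_continuous D (P i)"
      unfolding absolutely_continuous_def
    proof
      fix A assume A: "A \<in> null_sets D"
      then have AN: "A \<in> sets N" using setsD by auto
      \<comment> \<open>The joint probability of \<open>X = i\<close> and \<open>Y\<close> in
        \<open>A\<close> is at most that of \<open>Y\<close> in \<open>A\<close>. As the prior is
        positive, null sets of \<open>D\<close> are null for \<open>P i\<close>.\<close>
      have "prior i * measure (P i) A \<le> measure D A"
        unfolding joint_prior[OF i AN, symmetric] D_def using AN
        by (subst measure_distr) (auto intro!: finite_measure_mono)
      also have "measure D A = 0" using A by (simp add: measure_def null_setsD1)
      finally have "measure (P i) A = 0" using pos
        by (simp add: mult_le_0_iff measure_le_0_iff)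
      then show "A \<in> null_sets (P i)"
        using AN setsP[OF i] by (simp add: null_sets_def Pi.emeasure_eq_measure)
    qed
    then show ?thesis
      using D.finite_measure_real_density[OF Pi.finite_measure_axioms] setsP[OF i] setsD by metis
  qed
  then obtain g where g: "\<And>i. i \<in> {1..m} \<Longrightarrow> 0 < prior i \<Longrightarrow>
      integrable D (g i) \<and> (\<forall>y. 0 \<le> g i y) \<and> P i = density D (\<lambda>y. ennreal (g i y))"
    by metis
  \<comment> \<open>A model of prior 0 need not be dominated by the law \<open>D\<close> of \<open>Y\<close>; its density is irrelevant.\<close>
  define a where "a i y = (if i \<in> {1..m} \<and> 0 < prior i then prior i * g i y else 0)" for i y
  have a_nn: "0 \<le> a i y" for i y using g prior_nn by (auto simp: a_def)
  have a_int: "integrable D (a i)" for i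
  proof (cases "i \<in> {1..m} \<and> 0 < prior i")
    case True
    then have "a i = (\<lambda>y. prior i * g i y)" by (auto simp: a_def)
    with g True show ?thesis by simp
  next
    case False
    then have "a i = (\<lambda>y. 0)" by (auto simp: a_def)
    then show ?thesis by simp
  qed
  have joint: "\<P>(\<omega> in \<Omega>. X \<omega> = i \<and> Y \<omega> \<in> A) = (\<integral>y. indicator A y * a i y \<partial>D)"
    if i: "i \<in> {1..m}" and A: "A \<in> sets N" for i A
  proof (cases "0 < prior i")
    case True
    interpret Pi: prob_space "P i" by (rule Pp[OF i])
    have gi: "integrable D (g i)" "\<And>y. 0 \<le> g i y" "P i = density D (\<lambda>y. ennreal (g i y))"
      using g[OF i True] by auto
    have [measurable]: "g i \<in> borel_measurable D" using gi(1) by simp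
    have "ennreal (measure (P i) A) = emeasure (density D (\<lambda>y. ennreal (g i y))) A"
      unfolding gi(3)[symmetric] by (rule Pi.emeasure_eq_measure[symmetric])
    also have "\<dots> = (\<integral>\<^sup>+ y. ennreal (indicator A y * g i y) \<partial>D)"
      using A by (subst emeasure_density)
        (auto simp: setsD ac_simps indicator_def intro!: nn_integral_cong)
    also have "\<dots> = ennreal (\<integral>y. indicator A y * g i y \<partial>D)"
      using A gi by (intro nn_integral_eq_integral integrable_mult_indicator[where 'b=real, simplified])
        (auto simp: setsD)
    finally have "measure (P i) A = (\<integral>y. indicator A y * g i y \<partial>D)"
      using gi(2) by (subst (asm) ennreal_inj) (auto intro!: Bochner_Integration.integral_nonneg)
    then have "prior i * measure (P i) A = (\<integral>y. prior i * (indicator A y * g i y) \<partial>D)"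
      by simp
    also have "\<dots> = (\<integral>y. indicator A y * a i y \<partial>D)"
      using i True by (intro Bochner_Integration.integral_cong) (auto simp: a_def)
    finally show ?thesis using joint_prior[OF i A] by simp
  next
    case False
    then have "prior i = 0" using prior_nn[of i] by simp
    with joint_prior[OF i A] show ?thesis by (simp add: a_def)
  qed

  \<comment> \<open>The first inequality\<close>
  have pair: "(\<integral>y. min (a i y) (a j y) \<partial>D) \<le> prior i powr \<alpha> * prior j powr (1 - \<alpha>) * H \<alpha> i j"
    if i: "i \<in> {1..m}" and j: "j \<in> {1..m}" and \<alpha>: "\<alpha> \<in> {0<..<1}" for i j \<alpha>
  proof (cases "0 < prior i \<and> 0 < prior j")
    case True
    have "(\<integral>y. min (prior i * g i y) (prior j * g j y) \<partial>D)
        \<le> prior i powr \<alpha> * prior j powr (1 - \<alpha>) * hellinger_integral \<alpha> (P i) (P j)"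
      using True g i j \<alpha> prior_nn prob_space.finite_measure[OF Pp[OF i]] prob_space.finite_measure[OF Pp[OF j]]
      by (intro integral_min_le_hellinger_integral D.sigma_finite_measure_axioms) auto
    with True i j show ?thesis by (simp add: a_def H_def)
  next
    case False
    \<comment> \<open>A vanishing prior makes one of the two nonnegative functions zero, hence also
      their minimum.\<close>
    then have "(\<lambda>y. min (a i y) (a j y)) = (\<lambda>y. 0)"
      using a_nn by (auto simp: a_def fun_eq_iff min_def antisym)
    then have "(\<integral>y. min (a i y) (a j y) \<partial>D) = 0" by simp
    then show ?thesis using H_nn by simp
  qed
  have "ereal (min_error_prob \<Omega> N m X Y) \<le> ereal (\<Sum>(i, j)\<in>?I. \<integral>y. min (a i y) (a j y) \<partial>D)"
    unfolding ereal_less_eq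
    using m by (intro min_error_prob_le_sum_integral_min[OF \<open>prob_space \<Omega>\<close> _ X Y setsD a_int a_nn joint]) simp_all
  also have "\<dots> = (\<Sum>(i, j)\<in>?I. ereal (\<integral>y. min (a i y) (a j y) \<partial>D))"
    by (simp add: split_def)
  \<comment> \<open>The integrals on the left are free of \<alpha>, so each pair can take its own
    infimum.\<close>
  also have "\<dots> \<le> (\<Sum>(i, j)\<in>?I. T i j)"
    using pair unfolding T by (intro sum_mono) (auto intro!: INF_greatest)
  finally have first: "ereal (min_error_prob \<Omega> N m X Y) \<le> (\<Sum>(i, j)\<in>?I. T i j)" .

  \<comment> \<open>The second inequality\<close>
  have prior_sum: "(\<Sum>i\<in>{1..m}. prior i) = 1"
  proof -
    have "(\<Sum>i\<in>{1..m}. prior i) = prob (\<Union>i\<in>{1..m}. {\<omega>\<in>space \<Omega>. X \<omega> = i})"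
      unfolding prior_def using Xi
      by (intro finite_measure_finite_Union[symmetric]) (auto simp: disjoint_family_on_def)
    also have "(\<Union>i\<in>{1..m}. {\<omega>\<in>space \<Omega>. X \<omega> = i}) = space \<Omega>"
      using measurable_space[OF X] by auto
    finally show ?thesis by (simp add: prob_space)
  qed
  have T_le: "T i j \<le> ereal (prior i + prior j) * E"
    if i: "i \<in> {1..m}" and j: "j \<in> {1..m}" and ij: "i \<noteq> j" for i j
  proof -
    have T_le_H: "T i j \<le> ereal ((prior i + prior j) * H \<alpha> i j)" if "\<alpha> \<in> {0<..<1}" for \<alpha>
      unfolding T using that prior_nn H_nn
      by (intro INF_lower2[OF that]) (auto intro!: mult_right_mono weighted_geometric_mean_le_add)
    \<comment> \<open>Finiteness, read off at the arbitrary order \<open>1/2\<close>, allows the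
      division by the prior sum to take place in the reals.\<close>
    have "0 \<le> T i j" unfolding T using H_nn by (intro INF_greatest) simp
    moreover have "T i j < \<infinity>" using T_le_H[of "1/2"] by (auto intro: le_less_trans)
    ultimately obtain t where t: "T i j = ereal t" "0 \<le> t" by (cases "T i j") auto
    show ?thesis
    proof (cases "prior i + prior j = 0")
      case True
      \<comment> \<open>The bound is 0 on both sides, since \<open>0 * E = 0\<close> in
        \<open>ereal\<close> for every \<open>E\<close>.\<close>
      then show ?thesis using T_le_H[of "1/2"] by (simp flip: zero_ereal_def)
    next
      case False
      then have pos: "0 < prior i + prior j" using prior_nn[of i] prior_nn[of j] by linarith
      \<comment> \<open>The quotient bounds the Hellinger integrals of all orders from below at
        once, because the prior sum is independent of the order.\<close>
      have "t / (prior i + prior j) \<le> hellinger_integral \<alpha> (P i) (P j)" if "\<alpha> \<in> {0<..<1}" for \<alpha>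
        using T_le_H[OF that] pos by (simp add: t H_def field_simps)
      then have "ereal (t / (prior i + prior j)) \<le> exp_base b (- chernoff_information b (P i) (P j))"
        by (rule le_exp_base_chernoff_information[OF b])
      also have "\<dots> \<le> E"
        unfolding E_def
      \<comment> \<open>Negation reverses the order, so the smallest Chernoff information gives the
        largest exponential.\<close>
      proof (rule exp_base_mono[OF b], subst ereal_minus_le_minus, rule Min_le)
        show "finite {chernoff_information b (P i) (P j) | i j. i \<in> {1..m} \<and> j \<in> {1..m} \<and> i \<noteq> j}"
          by (rule finite_subset[of _ "(\<lambda>(i, j). chernoff_information b (P i) (P j)) ` ({1..m} \<times> {1..m})"])
            auto
      qed (use i j ij in blast)
      finally have "ereal (prior i + prior j) * ereal (t / (prior i + prior j)) \<le> ereal (prior i + prior j) * E"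
        using pos by (intro ereal_mult_left_mono) auto
      then show ?thesis using pos by (simp add: t)
    qed
  qed
  have "(\<Sum>(i, j)\<in>?I. T i j) \<le> (\<Sum>(i, j)\<in>?I. ereal (prior i + prior j) * E)"
    by (intro sum_mono) (auto intro!: T_le)
  \<comment> \<open>Extracting \<open>E\<close> from the sum relies on nonnegative coefficients, as
    \<open>ereal\<close> is not distributive in general.\<close>
  also have "\<dots> = (\<Sum>x\<in>?I. ereal (case x of (i, j) \<Rightarrow> prior i + prior j)) * E"
    using prior_nn by (subst sum_ereal_left_distrib) (auto simp: split_def)
  also have "(\<Sum>x\<in>?I. ereal (case x of (i, j) \<Rightarrow> prior i + prior j)) = ereal (real m - 1)"
    using sum_ordered_pairs_add[of m prior, unfolded prior_sum] m by simp
  finally have "(\<Sum>(i, j)\<in>?I. T i j) \<le> ereal (real m - 1) * E" .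
  with first show ?thesis
    unfolding Let_def E_def T_def prior_def by blast
qed

end
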